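(* Let $\varphi:S^1\to S^1$ be an orientation preserving homeomorphism with irrational rotation number. (1) If $\varphi$ is transitive, then for all $z\in S^1$ the displacement sequence $\{\eta_n(z)\}$ is almost strongly recurrent, i.e. $$\forall_{\varepsilon>0}\ \exists_{N\in\mathbb{N}}\ \forall_{n\in\mathbb{N}}\ \forall_{k\in\mathbb{N}\cup\{0\}}\ \exists_{i\in\{0,1,\dots,N\}}\ |\eta_{n+k+i}(z)-\eta_n(z)|<\varepsilon .$$ (2) If $\varphi$ is not transitive, then the sequence $\{\eta_n(z)\}$ is almost strongly recurrent for all $z\in\Delta$.
   Context: $S^1$ is covered by $\mathbb{R}$ via $x\mapsto\exp(2\pi\mathrm{i}x)$, $\Phi:\mathbb{R}\to\mathbb{R}$ is a lift of $\varphi$, the rotation number is $\lim_{n}\Phi^n(x)/n\bmod 1$. The displacement sequence of $z=\exp(2\pi\mathrm{i}x)$ is $\eta_n(z)=\Phi^n(x)-\Phi^{n-1}(x)\bmod 1\in[0,1)$, $n=1,2,\dots$. If $\varphi$ is not transitive, $\Delta\subset S^1$ is its unique minimal set. A sequence $\{a_n\}_{n\in\mathbb{N}}$ is almost strongly recurrent if $\forall_{\varepsilon>0}\ \exists_{N\in\mathbb{N}}\ \forall_{n\in\mathbb{N}}\ \forall_{k\in\mathbb{N}}\ \exists_{i\in\{0,1,\dots,N\}}\ |a_{n+k+i}-a_n|<\varepsilon$. *)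

theory Defs
  imports "HOL-Analysis.Analysis"
begin

abbreviation circle :: "complex set" where
  "circle \<equiv> sphere 0 1"

definition circle_cover :: "real \<Rightarrow> complex" where
  "circle_cover x = exp (2 * of_real pi * \<i> * of_real x)"

definition is_lift :: "(complex \<Rightarrow> complex) \<Rightarrow> (real \<Rightarrow> real) \<Rightarrow> bool" where
  "is_lift \<phi> \<Phi> \<longleftrightarrow>
     continuous_on UNIV \<Phi> \<and> (\<forall>x. circle_cover (\<Phi> x) = \<phi> (circle_cover x))"

text \<open>Only the values of \<open>\<phi>\<close> on the circle matter. Any two lifts differ by an integer
  constant, so it makes no difference whether one lift or every lift is required to be
  increasing.\<close>

definition orientation_preserving_circle_homeo :: "(complex \<Rightarrow> complex) \<Rightarrow> bool" where
  "orientation_preserving_circle_homeo \<phi> \<longleftrightarrow>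
     (\<exists>\<psi>. homeomorphism circle circle \<phi> \<psi>) \<and> (\<exists>\<Phi>. is_lift \<phi> \<Phi> \<and> strict_mono \<Phi>)"

text \<open>For a lift \<open>\<Phi>\<close> of an orientation preserving homeomorphism the limit of
  \<open>\<Phi>\<^sup>n(x) / n\<close> exists and is the same for every \<open>x\<close>; the base point \<open>0\<close> is an
  arbitrary choice. Modulo 1 the limit does not depend on the lift either.\<close>

definition rotation_number :: "(real \<Rightarrow> real) \<Rightarrow> real" where
  "rotation_number \<Phi> = frac (lim (\<lambda>n. (\<Phi> ^^ n) 0 / real n))"

text \<open>The displacement sequence of the point \<open>circle_cover x\<close>, meant for \<open>n \<ge> 1\<close>; it does
  not depend on the choice of \<open>x\<close> over that point, nor on the lift.\<close>

definition displacement :: "(real \<Rightarrow> real) \<Rightarrow> real \<Rightarrow> nat \<Rightarrow> real" where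
  "displacement \<Phi> x n = frac ((\<Phi> ^^ n) x - (\<Phi> ^^ (n - 1)) x)"

text \<open>Existence of a dense two-sided orbit: the set below is \<open>{\<phi>\<^sup>n(x) | n \<in> \<int>}\<close> for a
  bijection \<open>\<phi>\<close> of \<open>S\<close>.\<close>

definition has_dense_orbit_on :: "'a::topological_space set \<Rightarrow> ('a \<Rightarrow> 'a) \<Rightarrow> bool" where
  "has_dense_orbit_on S \<phi> \<longleftrightarrow>
     (\<exists>x\<in>S. S \<subseteq> closure {y \<in> S. \<exists>n. y = (\<phi> ^^ n) x \<or> (\<phi> ^^ n) y = x})"

abbreviation transitive_circle_map :: "(complex \<Rightarrow> complex) \<Rightarrow> bool" where
  "transitive_circle_map \<equiv> has_dense_orbit_on circle"

definition closed_invariant_circle_set :: "(complex \<Rightarrow> complex) \<Rightarrow> complex set \<Rightarrow> bool" where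
  "closed_invariant_circle_set \<phi> M \<longleftrightarrow> M \<noteq> {} \<and> M \<subseteq> circle \<and> closed M \<and> \<phi> ` M = M"

definition is_minimal_set :: "(complex \<Rightarrow> complex) \<Rightarrow> complex set \<Rightarrow> bool" where
  "is_minimal_set \<phi> M \<longleftrightarrow>
     closed_invariant_circle_set \<phi> M \<and>
     (\<forall>M'. closed_invariant_circle_set \<phi> M' \<and> M' \<subseteq> M \<longrightarrow> M' = M)"

text \<open>There is exactly one minimal set when the rotation number is irrational; otherwise the
  definite description below may be meaningless.\<close>

definition the_minimal_set :: "(complex \<Rightarrow> complex) \<Rightarrow> complex set" where
  "the_minimal_set \<phi> = (THE M. is_minimal_set \<phi> M)"

text \<open>Sequences are indexed by \<open>n \<ge> 1\<close>; the value at \<open>0\<close> is ignored.\<close>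

definition almost_strongly_recurrent :: "(nat \<Rightarrow> real) \<Rightarrow> bool" where
  "almost_strongly_recurrent a \<longleftrightarrow>
     (\<forall>\<epsilon>>0. \<exists>N\<ge>1. \<forall>n\<ge>1. \<forall>k. \<exists>i\<in>{0..N}. \<bar>a (n + k + i) - a n\<bar> < \<epsilon>)"

end

theory Submission
  imports Defs
begin

text \<open>The displacement \<open>\<eta>\<^sub>n\<close> of a point is \<open>g\<close> evaluated at the point of its orbit at time
  \<open>n - 1\<close>, where \<open>g t = frac (\<Phi> t - t)\<close> has period 1. A value \<open>\<Phi> t - t\<close> that is an integer would
  give a fixed point on the circle and hence a rational rotation number, so \<open>g\<close> avoids the
  discontinuities of \<open>frac\<close> and is continuous. On a minimal set every forward orbit is dense, and
  compactness bounds the waiting time until the orbit of \<open>w\<close> has a displacement within \<open>\<epsilon>\<close> of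
  \<open>g s\<close>, uniformly in the starting point \<open>w\<close> and the target \<open>s\<close>
  (\<open>uniform_approximation_of_displacement\<close>). With \<open>s\<close> and \<open>w\<close> the points of the orbit at times
  \<open>n - 1\<close> and \<open>n + k - 1\<close> this is almost strong recurrence.

  It remains to see that there is exactly one minimal set, and that it is the whole circle if there
  is a dense orbit. Both follow from one property of irrational rotation numbers, proved on the
  line: two points over the same forward orbit, taken at different times, are always separated
  by a point of any given closed invariant set, unless the orbit lies in this set
  (\<open>invariant_meets_segment\<close>). A limit point of an orbit is approached by such pairs, hence by points
  of every closed invariant set. So each \<open>\<omega>\<close>-limit set is contained in all closed
  invariant sets (\<open>limit_set_least\<close>). And if a closed invariant set had a gap, a dense orbit would
  put two of its points into a short piece of this gap
  (\<open>transitive_imp_invariant_trivial\<close>).\<close>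

section \<open>The covering of the circle by the line\<close>

lemma circle_cover_eq_iff: "circle_cover x = circle_cover y \<longleftrightarrow> (\<exists>k::int. x = y + of_int k)"
proof -
  have "circle_cover x = circle_cover y \<longleftrightarrow>
        (\<exists>n::int. 2 * of_real pi * \<i> * of_real x
            = 2 * of_real pi * \<i> * of_real y + (of_int (2 * n) * of_real pi) * \<i>)"
    by (simp add: circle_cover_def exp_eq)
  also have "\<dots> \<longleftrightarrow> (\<exists>n::int. x = y + of_int n)"
  proof (rule ex_cong1)
    fix n :: int
    have "2 * of_real pi * \<i> * of_real y + (of_int (2 * n) * of_real pi) * \<i>
        = 2 * of_real pi * \<i> * of_real (y + of_int n)"
      by (simp add: algebra_simps)
    then show "2 * of_real pi * \<i> * of_real x
            = 2 * of_real pi * \<i> * of_real y + (of_int (2 * n) * of_real pi) * \<i>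
          \<longleftrightarrow> x = y + of_int n"
      by (simp del: of_real_add)
  qed
  finally show ?thesis .
qed

lemma circle_cover_add_int [simp]: "circle_cover (x + of_int k) = circle_cover x"
  by (auto simp: circle_cover_eq_iff)

lemma circle_cover_in_circle [simp]: "circle_cover x \<in> circle"
proof -
  have "circle_cover x = exp (\<i> * of_real (2 * pi * x))"
    by (simp add: circle_cover_def algebra_simps)
  then show ?thesis by simp
qed

lemma circle_cover_onto:
  assumes "z \<in> circle"
  obtains x where "circle_cover x = z"
proof
  have "2 * of_real pi * \<i> * of_real (Arg z / (2 * pi)) = \<i> * of_real (Arg z)"
    by simp
  then show "circle_cover (Arg z / (2 * pi)) = z"
    using assms complex_norm_eq_1_exp_eq[of z] by (simp only: circle_cover_def) simp
qed

lemma continuous_on_circle_cover: "continuous_on A circle_cover"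
  unfolding circle_cover_def by (intro continuous_intros)

lemma closed_circle_cover_image:
  assumes "closed S" and per: "\<And>x (k::int). x + of_int k \<in> S \<longleftrightarrow> x \<in> S"
  shows "closed (circle_cover ` S)"
proof -
  \<comment> \<open>By periodicity one period of \<open>S\<close>, which is compact, has the same image.\<close>
  have "circle_cover ` S = circle_cover ` ({0..1} \<inter> S)"
  proof
    show "circle_cover ` S \<subseteq> circle_cover ` ({0..1} \<inter> S)"
    proof
      fix z assume "z \<in> circle_cover ` S"
      then obtain x where x: "x \<in> S" "z = circle_cover x" by blast
      have eq: "x = frac x + of_int \<lfloor>x\<rfloor>" by (simp add: frac_def)
      then have "frac x \<in> S" using x(1) per by metis
      moreover have "frac x \<in> {0..1}" by (simp add: frac_lt_1 less_imp_le)
      moreover have "z = circle_cover (frac x)"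
        using x(2) eq circle_cover_add_int by metis
      ultimately show "z \<in> circle_cover ` ({0..1} \<inter> S)" by blast
    qed
  qed blast
  moreover have "compact (circle_cover ` ({0..1} \<inter> S))"
    using assms(1) by (intro compact_continuous_image continuous_on_circle_cover
        compact_Int_closed compact_Icc)
  ultimately show ?thesis by (simp add: compact_imp_closed)
qed

lemma continuous_integer_valued_constant:
  fixes f :: "real \<Rightarrow> real"
  assumes "continuous_on UNIV f" and int: "\<And>x. f x \<in> \<int>"
  shows "f x = f y"
proof -
  have "f constant_on UNIV"
  proof (rule continuous_discrete_range_constant)
    fix x :: real
    have "1 \<le> norm (f y - f x)" if "f y \<noteq> f x" for y
      using Ints_nonzero_abs_ge1[of "f y - f x"] that int by simp
    then show "\<exists>e>0. \<forall>y. y \<in> UNIV \<and> f y \<noteq> f x \<longrightarrow> e \<le> norm (f y - f x)"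
      by (intro exI[of _ 1]) auto
  qed (use assms(1) in auto)
  then show ?thesis unfolding constant_on_def by (metis UNIV_I)
qed

section \<open>Increasing lifts of degree one\<close>

locale degree_one_lift =
  fixes \<Phi> :: "real \<Rightarrow> real"
  assumes cont: "continuous_on UNIV \<Phi>"
    and mono: "strict_mono \<Phi>"
    and degree_one: "\<Phi> (x + 1) = \<Phi> x + 1"
begin

lemma lift_add_int: "\<Phi> (x + of_int k) = \<Phi> x + of_int k"
proof (induction k arbitrary: x rule: int_induct[where k = 0])
  case (step1 i)
  have "\<Phi> (x + of_int (i + 1)) = \<Phi> ((x + of_int i) + 1)" by (simp add: algebra_simps)
  then show ?case using step1 degree_one[of "x + of_int i"] by simp
next
  case (step2 i)
  have "\<Phi> (x + of_int i) = \<Phi> ((x + of_int (i - 1)) + 1)" by (simp add: algebra_simps)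
  then show ?case using step2 degree_one[of "x + of_int (i - 1)"] by simp
qed simp

lemma funpow_add_int: "(\<Phi> ^^ n) (x + of_int k) = (\<Phi> ^^ n) x + of_int k"
  by (induction n) (auto simp: lift_add_int)

lemma funpow_continuous: "continuous_on UNIV (\<Phi> ^^ n)"
proof (induction n)
  case (Suc n)
  have "continuous_on UNIV (\<lambda>x. \<Phi> ((\<Phi> ^^ n) x))"
    by (rule continuous_on_compose2[OF cont Suc]) auto
  then show ?case by (simp add: o_def)
qed (simp add: id_def)

lemma funpow_strict_mono: "strict_mono (\<Phi> ^^ n)"
  by (induction n) (auto simp: strict_mono_def strict_monoD[OF mono])

text \<open>A point that \<open>\<Phi>\<^sup>q\<close> moves by the integer \<open>p\<close> advances by \<open>p / q\<close> per step on average, and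
  every other orbit stays within bounded distance of an integer translate of its orbit. So only
  irrationality of the rotation number enters the dynamics below through the absence of such
  points.\<close>

lemma periodic_imp_rational_rotation_number:
  assumes per: "(\<Phi> ^^ q) a = a + of_int p" and q: "q \<ge> 1"
  shows "rotation_number \<Phi> \<in> \<rat>"
proof -
  define c where "c n = (\<Phi> ^^ n) a - real n * (of_int p / real q)" for n
  have c_step: "c (n + q) = c n" for n
  proof -
    have "(\<Phi> ^^ (n + q)) a = (\<Phi> ^^ n) a + of_int p"
      by (simp add: funpow_add per funpow_add_int)
    then show ?thesis using q by (simp add: c_def field_simps)
  qed
  have c_steps: "c (r + j * q) = c r" for r j
  proof (induction j)
    case (Suc j)
    have "c (r + Suc j * q) = c ((r + j * q) + q)" by (simp add: algebra_simps)
    then show ?case using Suc c_step by simp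
  qed simp
  define B where "B = Max ((\<lambda>r. \<bar>c r\<bar>) ` {..<q})"
  have c_bound: "\<bar>c n\<bar> \<le> B" for n
  proof -
    have "c n = c (n mod q)" using c_steps[of "n mod q" "n div q"] by simp
    moreover have "\<bar>c (n mod q)\<bar> \<le> B" unfolding B_def using q by (intro Max_ge) auto
    ultimately show ?thesis by simp
  qed
  define l where "l = \<lfloor>a\<rfloor>"
  have near: "\<bar>(\<Phi> ^^ n) 0 - (\<Phi> ^^ n) a\<bar> \<le> \<bar>of_int l\<bar> + 1" for n
  proof -
    have m: "mono (\<Phi> ^^ n)" by (rule strict_mono_mono[OF funpow_strict_mono])
    have "0 + of_int l \<le> a" "a \<le> 0 + of_int (l + 1)" unfolding l_def by linarith+
    then have "(\<Phi> ^^ n) (0 + of_int l) \<le> (\<Phi> ^^ n) a"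
      "(\<Phi> ^^ n) a \<le> (\<Phi> ^^ n) (0 + of_int (l + 1))"
      using monoD[OF m] by blast+
    then show ?thesis unfolding funpow_add_int by linarith
  qed
  have "(\<lambda>n. (\<Phi> ^^ n) 0 / real n - of_int p / real q) \<longlonglongrightarrow> 0"
  proof (rule Lim_null_comparison)
    have "norm ((\<Phi> ^^ n) 0 / real n - of_int p / real q) \<le> (\<bar>of_int l\<bar> + 1 + B) / real n"
      if "n \<ge> 1" for n
    proof -
      have "\<bar>(\<Phi> ^^ n) 0 - real n * (of_int p / real q)\<bar> \<le> \<bar>of_int l\<bar> + 1 + B"
        using near[of n] c_bound[of n] unfolding c_def by linarith
      moreover have "(\<Phi> ^^ n) 0 / real n - of_int p / real q
          = ((\<Phi> ^^ n) 0 - real n * (of_int p / real q)) / real n"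
        using that by (simp add: diff_divide_distrib)
      ultimately show ?thesis using that by (simp add: divide_right_mono)
    qed
    then show "\<forall>\<^sub>F n in sequentially. norm ((\<Phi> ^^ n) 0 / real n - of_int p / real q)
        \<le> (\<bar>of_int l\<bar> + 1 + B) / real n"
      by (auto simp: eventually_sequentially)
    show "(\<lambda>n. (\<bar>of_int l\<bar> + 1 + B) / real n) \<longlonglongrightarrow> 0" by (rule lim_const_over_n)
  qed
  then have "lim (\<lambda>n. (\<Phi> ^^ n) 0 / real n) = of_int p / real q"
    by (intro limI) (simp add: LIM_zero_iff)
  then show ?thesis by (simp add: rotation_number_def)
qed

end

lemma lift_degree_one:
  assumes homeo: "orientation_preserving_circle_homeo \<phi>" and lift: "is_lift \<phi> \<Phi>"
  shows "degree_one_lift \<Phi>"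
proof
  show cont: "continuous_on UNIV \<Phi>" using lift by (simp add: is_lift_def)
  from homeo obtain \<psi> \<Psi> where \<psi>: "homeomorphism circle circle \<phi> \<psi>"
    and \<Psi>: "is_lift \<phi> \<Psi>" "strict_mono \<Psi>"
    unfolding orientation_preserving_circle_homeo_def by blast
  have semi: "circle_cover (\<Phi> x) = \<phi> (circle_cover x)" for x
    using lift by (simp add: is_lift_def)
  have "\<Phi> x - \<Psi> x \<in> \<int>" for x
  proof -
    have "circle_cover (\<Phi> x) = circle_cover (\<Psi> x)" using lift \<Psi>(1) by (simp add: is_lift_def)
    then show ?thesis by (auto simp: circle_cover_eq_iff)
  qed
  moreover have "continuous_on UNIV (\<lambda>x. \<Phi> x - \<Psi> x)"
    using cont \<Psi>(1) by (intro continuous_intros) (auto simp: is_lift_def)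
  ultimately have diff: "\<Phi> x - \<Psi> x = \<Phi> y - \<Psi> y" for x y
    by (intro continuous_integer_valued_constant[of "\<lambda>x. \<Phi> x - \<Psi> x"]) auto
  show mono: "strict_mono \<Phi>"
  proof (rule strict_monoI)
    fix x y :: real assume "x < y"
    then show "\<Phi> x < \<Phi> y" using strict_monoD[OF \<Psi>(2)] diff[of x y] by fastforce
  qed
  fix x
  have "circle_cover (\<Phi> (x + 1)) = circle_cover (\<Phi> x)"
    using semi circle_cover_add_int[of x 1] by simp
  then obtain d :: int where d: "\<Phi> (x + 1) = \<Phi> x + of_int d"
    by (auto simp: circle_cover_eq_iff)
  have "d > 0" using d strict_monoD[OF mono, of x "x + 1"] by simp
  moreover have "\<not> d \<ge> 2"
  proof
    \<comment> \<open>A lift that advances by 2 or more over a period takes congruent values at two points less than 1 apart.\<close>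
    assume "d \<ge> 2"
    then have "of_int d \<ge> (2::real)" by simp
    then have le: "\<Phi> x \<le> \<Phi> x + 1" "\<Phi> x + 1 \<le> \<Phi> (x + 1)" using d by auto
    obtain y where y: "x \<le> y" "y \<le> x + 1" "\<Phi> y = \<Phi> x + 1"
      using IVT'[of \<Phi> x "\<Phi> x + 1" "x + 1"] le continuous_on_subset[OF cont] by auto
    have "x \<noteq> y" "y \<noteq> x + 1" using y(3) d \<open>of_int d \<ge> (2::real)\<close> by auto
    have "\<phi> (circle_cover y) = \<phi> (circle_cover x)"
      using y(3) semi[of y] semi[of x] circle_cover_add_int[of "\<Phi> x" 1] by simp
    then have "circle_cover y = circle_cover x"
      using homeomorphism_apply1[OF \<psi>] circle_cover_in_circle by metis
    then obtain k :: int where "y = x + of_int k" by (auto simp: circle_cover_eq_iff)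
    then have "0 < k" "k < 1" using y \<open>x \<noteq> y\<close> \<open>y \<noteq> x + 1\<close> by linarith+
    then show False by simp
  qed
  ultimately have "d = 1" by simp
  then show "\<Phi> (x + 1) = \<Phi> x + 1" using d by simp
qed

section \<open>Limit sets of a lift with irrational rotation number\<close>

locale irrational_lift = degree_one_lift +
  assumes aperiodic: "q \<ge> 1 \<Longrightarrow> (\<Phi> ^^ q) x \<noteq> x + of_int (p::int)"
begin

text \<open>These are the preimages in the line of the nonempty closed subsets of the circle that are
  mapped onto themselves.\<close>

definition invariant :: "real set \<Rightarrow> bool" where
  "invariant S \<longleftrightarrow> closed S \<and> S \<noteq> {} \<and> (\<forall>x (k::int). x + of_int k \<in> S \<longleftrightarrow> x \<in> S)
     \<and> (\<forall>x. \<Phi> x \<in> S \<longleftrightarrow> x \<in> S)"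

lemma invariant_translate: "invariant S \<Longrightarrow> x + of_int k \<in> S \<longleftrightarrow> x \<in> S"
  by (simp add: invariant_def)

lemma invariant_funpow: "invariant S \<Longrightarrow> (\<Phi> ^^ n) x \<in> S \<longleftrightarrow> x \<in> S"
  by (induction n) (auto simp: invariant_def)

text \<open>This is the wandering property of the gaps of an invariant set: distinct points over the
  forward orbit of \<open>z\<close> never share a gap. The map \<open>F = \<Phi>\<^sup>q + p\<close> has no fixed point, so it moves
  all points in the same direction. If it moves them to the right, take the last point \<open>a\<close> of
  \<open>S\<close> before \<open>z\<close>: its image is in \<open>S\<close>, lies beyond \<open>a\<close> and hence beyond \<open>z\<close>, and lies before
  \<open>F z\<close>.\<close>

lemma invariant_meets_segment:
  fixes p :: int
  assumes S: "invariant S" and z: "z \<notin> S" and q: "q \<ge> 1"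
  shows "\<exists>s\<in>S. s \<in> closed_segment z ((\<Phi> ^^ q) z + of_int p)"
proof -
  define F where "F t = (\<Phi> ^^ q) t + of_int p" for t
  have closed: "closed S" using S by (simp add: invariant_def)
  have F_cont: "continuous_on A F" for A
    unfolding F_def by (intro continuous_intros continuous_on_subset[OF funpow_continuous]) auto
  have F_mono: "F s < F t" if "s < t" for s t
    using that strict_monoD[OF funpow_strict_mono] by (simp add: F_def)
  have F_inv: "F t \<in> S" if "t \<in> S" for t
    using that S by (simp add: F_def invariant_translate invariant_funpow)
  have F_fix: "F t \<noteq> t" for t
    using aperiodic[OF q, of t "-p"] by (auto simp: F_def)
  obtain s where s: "s \<in> S" using S by (auto simp: invariant_def)
  have "s - of_int \<lceil>s - z\<rceil> \<le> z" "z \<le> s + of_int \<lceil>z - s\<rceil>" by linarith+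
  moreover have "s - of_int \<lceil>s - z\<rceil> \<in> S" "s + of_int \<lceil>z - s\<rceil> \<in> S"
    using s S invariant_translate[of S s "- \<lceil>s - z\<rceil>"] invariant_translate[of S s "\<lceil>z - s\<rceil>"]
    by auto
  ultimately have ne: "S \<inter> {..z} \<noteq> {}" "S \<inter> {z..} \<noteq> {}" by auto
  consider "z < F z" | "F z < z" using F_fix[of z] by linarith
  then show ?thesis
  proof cases
    case 1
    define a where "a = Sup (S \<inter> {..z})"
    have bdd: "bdd_above (S \<inter> {..z})" by (auto intro: bdd_aboveI)
    have "a \<in> S \<inter> {..z}"
      unfolding a_def using ne(1) bdd closed by (intro closed_contains_Sup closed_Int) auto
    then have a: "a \<in> S" "a < z" using z by (auto simp: le_less)
    have "a < F a"
    proof (rule ccontr)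
      assume "\<not> a < F a"
      moreover have "continuous_on {a..z} (\<lambda>t. F t - t)" by (intro continuous_intros F_cont)
      ultimately obtain t where "F t = t"
        using IVT'[of "\<lambda>t. F t - t" a 0 z] 1 a(2) by auto
      then show False using F_fix by simp
    qed
    moreover have "F a \<le> a" if "F a \<le> z"
      unfolding a_def using that bdd F_inv[OF a(1)] by (intro cSup_upper) (auto simp: a_def)
    ultimately have "z < F a" by linarith
    then show ?thesis
      using F_inv[OF a(1)] F_mono[OF a(2)] 1
      by (intro bexI[of _ "F a"]) (auto simp: closed_segment_eq_real_ivl F_def)
  next
    case 2
    define b where "b = Inf (S \<inter> {z..})"
    have bdd: "bdd_below (S \<inter> {z..})" by (auto intro: bdd_belowI)
    have "b \<in> S \<inter> {z..}"
      unfolding b_def using ne(2) bdd closed by (intro closed_contains_Inf closed_Int) auto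
    then have b: "b \<in> S" "z < b" using z by (auto simp: le_less)
    have "F b < b"
    proof (rule ccontr)
      assume "\<not> F b < b"
      moreover have "continuous_on {z..b} (\<lambda>t. F t - t)" by (intro continuous_intros F_cont)
      ultimately obtain t where "F t = t"
        using IVT'[of "\<lambda>t. F t - t" z 0 b] 2 b(2) by auto
      then show False using F_fix by simp
    qed
    moreover have "b \<le> F b" if "z \<le> F b"
      unfolding b_def using that bdd F_inv[OF b(1)] by (intro cInf_lower) (auto simp: b_def)
    ultimately have "F b < z" by linarith
    then show ?thesis
      using F_inv[OF b(1)] F_mono[OF b(2)] 2
      by (intro bexI[of _ "F b"]) (auto simp: closed_segment_eq_real_ivl F_def)
  qed
qed

text \<open>The preimage in the line of the \<open>\<omega>\<close>-limit set of the point of the circle below \<open>w\<close>.\<close>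

definition limit_set :: "real \<Rightarrow> real set" where
  "limit_set w = {u. \<forall>\<delta>>0. \<forall>n0. \<exists>n\<ge>n0. \<exists>k::int. \<bar>(\<Phi> ^^ n) w + of_int k - u\<bar> < \<delta>}"

lemma limit_setD:
  assumes "u \<in> limit_set w" "\<delta> > 0"
  obtains n and k :: int where "n \<ge> n0" "\<bar>(\<Phi> ^^ n) w + of_int k - u\<bar> < \<delta>"
  using assms unfolding limit_set_def by blast

lemma limit_set_nonempty: "limit_set w \<noteq> {}"
proof -
  obtain l r where r: "strict_mono (r :: nat \<Rightarrow> nat)"
    and l: "((\<lambda>n. frac ((\<Phi> ^^ n) w)) \<circ> r) \<longlonglongrightarrow> l"
    using compact_Icc[of "0::real" 1, unfolded compact_def, rule_format,
        of "\<lambda>n. frac ((\<Phi> ^^ n) w)"]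
    by (auto simp: frac_lt_1 less_imp_le)
  have "l \<in> limit_set w"
    unfolding limit_set_def
  proof safe
    fix \<delta> :: real and n0 :: nat assume "\<delta> > 0"
    then obtain N where N: "\<And>n. n \<ge> N \<Longrightarrow> dist (frac ((\<Phi> ^^ r n) w)) l < \<delta>"
      using l unfolding LIMSEQ_def by auto
    define n where "n = max N n0"
    have "r n \<ge> n0" using seq_suble[OF r, of n] by (simp add: n_def)
    moreover have "\<bar>(\<Phi> ^^ r n) w + of_int (- \<lfloor>(\<Phi> ^^ r n) w\<rfloor>) - l\<bar> < \<delta>"
      using N[of n] by (simp add: n_def frac_def dist_real_def)
    ultimately show "\<exists>n\<ge>n0. \<exists>k::int. \<bar>(\<Phi> ^^ n) w + of_int k - l\<bar> < \<delta>" by blast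
  qed
  then show ?thesis by blast
qed

lemma closed_limit_set: "closed (limit_set w)"
proof -
  have "u \<in> limit_set w" if u: "u \<in> closure (limit_set w)" for u
    unfolding limit_set_def
  proof safe
    fix \<delta> :: real and n0 :: nat assume "\<delta> > 0"
    then obtain v where v: "v \<in> limit_set w" "dist v u < \<delta> / 2"
      using u by (meson closure_approachable half_gt_zero)
    obtain n k where "n \<ge> n0" "\<bar>(\<Phi> ^^ n) w + of_int k - v\<bar> < \<delta> / 2"
      using limit_setD[OF v(1)] \<open>\<delta> > 0\<close> by (metis half_gt_zero)
    moreover from this v(2) have "\<bar>(\<Phi> ^^ n) w + of_int k - u\<bar> < \<delta>"
      by (simp add: dist_real_def abs_if split: if_splits)
    ultimately show "\<exists>n\<ge>n0. \<exists>k::int. \<bar>(\<Phi> ^^ n) w + of_int k - u\<bar> < \<delta>" by blast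
  qed
  then show ?thesis by (metis closure_subset_eq subsetI)
qed

lemma limit_set_translate: "u + of_int (j::int) \<in> limit_set w \<longleftrightarrow> u \<in> limit_set w"
proof -
  have shift: "u + of_int j \<in> limit_set w" if u: "u \<in> limit_set w" for u and j :: int
    unfolding limit_set_def
  proof safe
    fix \<delta> :: real and n0 :: nat assume "\<delta> > 0"
    obtain n k where "n \<ge> n0" "\<bar>(\<Phi> ^^ n) w + of_int k - u\<bar> < \<delta>"
      using limit_setD[OF u \<open>\<delta> > 0\<close>] by metis
    moreover from this have "\<bar>(\<Phi> ^^ n) w + of_int (k + j) - (u + of_int j)\<bar> < \<delta>" by simp
    ultimately show "\<exists>n\<ge>n0. \<exists>k::int. \<bar>(\<Phi> ^^ n) w + of_int k - (u + of_int j)\<bar> < \<delta>"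
      by blast
  qed
  show ?thesis using shift[of u j] shift[of "u + of_int j" "- j"] by auto
qed

lemma limit_set_lift_iff: "\<Phi> u \<in> limit_set w \<longleftrightarrow> u \<in> limit_set w"
proof
  assume u: "u \<in> limit_set w"
  show "\<Phi> u \<in> limit_set w"
    unfolding limit_set_def
  proof safe
    fix \<delta> :: real and n0 :: nat assume "\<delta> > 0"
    then obtain \<eta> where \<eta>: "\<eta> > 0" "\<And>t. \<bar>t - u\<bar> < \<eta> \<Longrightarrow> \<bar>\<Phi> t - \<Phi> u\<bar> < \<delta>"
      using cont unfolding continuous_on_iff by (metis UNIV_I dist_real_def)
    obtain n k where n: "n \<ge> n0" "\<bar>(\<Phi> ^^ n) w + of_int k - u\<bar> < \<eta>"
      using limit_setD[OF u \<eta>(1)] by metis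
    have "\<bar>(\<Phi> ^^ Suc n) w + of_int k - \<Phi> u\<bar> < \<delta>"
      using \<eta>(2)[OF n(2)] by (simp add: lift_add_int)
    then show "\<exists>n\<ge>n0. \<exists>k::int. \<bar>(\<Phi> ^^ n) w + of_int k - \<Phi> u\<bar> < \<delta>"
      using n(1) le_Suc_eq by blast
  qed
next
  assume u: "\<Phi> u \<in> limit_set w"
  show "u \<in> limit_set w"
    unfolding limit_set_def
  proof safe
    fix \<delta> :: real and n0 :: nat assume "\<delta> > 0"
    \<comment> \<open>Monotonicity takes the role of continuity of the inverse map.\<close>
    define \<eta> where "\<eta> = min (\<Phi> (u + \<delta>) - \<Phi> u) (\<Phi> u - \<Phi> (u - \<delta>))"
    have "\<eta> > 0"
      using strict_monoD[OF mono, of u "u + \<delta>"] strict_monoD[OF mono, of "u - \<delta>" u] \<open>\<delta> > 0\<close>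
      by (simp add: \<eta>_def)
    then obtain n k where n: "n \<ge> Suc n0" "\<bar>(\<Phi> ^^ n) w + of_int k - \<Phi> u\<bar> < \<eta>"
      using limit_setD[OF u] by metis
    then obtain m where m: "n = Suc m" "m \<ge> n0" by (cases n) auto
    define t where "t = (\<Phi> ^^ m) w + of_int k"
    have "\<bar>\<Phi> t - \<Phi> u\<bar> < \<eta>" using n(2) by (simp add: m(1) t_def lift_add_int)
    then have "\<Phi> t < \<Phi> (u + \<delta>)" "\<Phi> (u - \<delta>) < \<Phi> t" by (auto simp: \<eta>_def)
    then have "\<bar>t - u\<bar> < \<delta>" unfolding strict_mono_less[OF mono] by simp
    then show "\<exists>n\<ge>n0. \<exists>k::int. \<bar>(\<Phi> ^^ n) w + of_int k - u\<bar> < \<delta>"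
      using m(2) t_def by blast
  qed
qed

lemma invariant_limit_set: "invariant (limit_set w)"
  by (simp add: invariant_def closed_limit_set limit_set_nonempty limit_set_translate
      limit_set_lift_iff)

text \<open>Near a limit point of the orbit of \<open>w\<close> there are two points over this orbit at different
  times, hence, by \<open>invariant_meets_segment\<close>, a point of \<open>S\<close> between them. Since limit sets are
  themselves invariant, they all coincide, and their common value is the least invariant set.
  This gives existence and uniqueness of the minimal set on the circle, and density of every
  forward orbit in it modulo 1.\<close>

lemma limit_set_least:
  assumes S: "invariant S"
  shows "limit_set w \<subseteq> S"
proof
  fix u assume u: "u \<in> limit_set w"
  have "\<exists>s\<in>S. dist s u < \<delta>" if \<delta>: "\<delta> > 0" for \<delta>
  proof -
    obtain n k where n: "\<bar>(\<Phi> ^^ n) w + of_int k - u\<bar> < \<delta>"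
      using limit_setD[OF u \<delta>] by metis
    obtain m l where m: "m \<ge> Suc n" "\<bar>(\<Phi> ^^ m) w + of_int l - u\<bar> < \<delta>"
      using limit_setD[OF u \<delta>] by metis
    define z where "z = (\<Phi> ^^ n) w + of_int k"
    have next_eq: "(\<Phi> ^^ (m - n)) z + of_int (l - k) = (\<Phi> ^^ m) w + of_int l"
    proof -
      have "(\<Phi> ^^ (m - n)) ((\<Phi> ^^ n) w) = (\<Phi> ^^ m) w"
        using m(1) by (metis Suc_leD comp_apply funpow_add le_add_diff_inverse2)
      then show ?thesis by (simp add: z_def funpow_add_int)
    qed
    show ?thesis
    proof (cases "z \<in> S")
      case True
      then show ?thesis using n by (auto simp: z_def dist_real_def)
    next
      case False
      have "m - n \<ge> 1" using m(1) by simp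
      then obtain s where "s \<in> S" "s \<in> closed_segment z ((\<Phi> ^^ (m - n)) z + of_int (l - k))"
        using invariant_meets_segment[OF S False] by blast
      then show ?thesis
        unfolding next_eq using n m(2)
        by (intro bexI[of _ s])
          (auto simp: z_def dist_real_def closed_segment_eq_real_ivl split: if_splits)
    qed
  qed
  then have "u \<in> closure S" by (auto simp: closure_approachable)
  then show "u \<in> S" using S by (simp add: invariant_def)
qed

section \<open>Uniform recurrence of the displacements\<close>

lemma continuous_on_frac_displacement: "continuous_on A (\<lambda>t. frac (\<Phi> t - t))"
proof -
  have "isCont (\<lambda>t. frac (\<Phi> t - t)) t" for t
  proof (rule isCont_o2[where f = "\<lambda>t. \<Phi> t - t" and g = frac])
    show "isCont (\<lambda>t. \<Phi> t - t) t"
      using cont by (intro continuous_intros) (simp add: continuous_on_eq_continuous_at)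
    have "\<Phi> t - t \<noteq> of_int k" for k using aperiodic[of 1 t k] by (auto simp: algebra_simps)
    then show "isCont frac (\<Phi> t - t)" by (intro continuous_frac) (auto elim: Ints_cases)
  qed
  then show ?thesis by (simp add: continuous_at_imp_continuous_on)
qed

text \<open>The time \<open>i\<close> at which the orbit of \<open>w\<close> comes close to \<open>s\<close> can be bounded uniformly: for
  fixed \<open>i\<close> the admissible pairs \<open>(w, s)\<close> form an open set, and finitely many of these sets
  cover the compact set of pairs in one period.\<close>

lemma uniform_approximation_of_displacement:
  assumes "\<epsilon> > 0"
  shows "\<exists>N. \<forall>w. \<forall>s\<in>limit_set v. \<exists>i\<le>N.
           \<bar>frac (\<Phi> ((\<Phi> ^^ i) w) - (\<Phi> ^^ i) w) - frac (\<Phi> s - s)\<bar> < \<epsilon>"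
proof -
  define g where "g t = frac (\<Phi> t - t)" for t
  have g_cont: "continuous_on UNIV g"
    unfolding g_def by (rule continuous_on_frac_displacement)
  have g_per: "g (t + of_int k) = g t" for t and k :: int
    by (simp add: g_def lift_add_int)
  define K where "K = limit_set v"
  define U where "U i = {p. \<bar>g ((\<Phi> ^^ i) (fst p)) - g (snd p)\<bar> < \<epsilon>}" for i
  have "open (U i)" for i
    unfolding U_def
    by (intro open_Collect_less continuous_intros continuous_on_compose2[OF g_cont]
        continuous_on_compose2[OF funpow_continuous]) auto
  moreover have "{0..1} \<times> ({0..1} \<inter> K) \<subseteq> (\<Union>i\<in>UNIV. U i)"
  proof clarify
    fix w s assume "s \<in> K"
    then have s: "s \<in> limit_set w"
      using limit_set_least[OF invariant_limit_set] by (auto simp: K_def)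
    obtain \<eta> where \<eta>: "\<eta> > 0" "\<And>t. \<bar>t - s\<bar> < \<eta> \<Longrightarrow> \<bar>g t - g s\<bar> < \<epsilon>"
      using g_cont assms unfolding continuous_on_iff by (metis UNIV_I dist_real_def)
    obtain i k where "\<bar>(\<Phi> ^^ i) w + of_int k - s\<bar> < \<eta>"
      using limit_setD[OF s \<eta>(1)] by metis
    from \<eta>(2)[OF this] have "(w, s) \<in> U i" by (simp add: U_def g_per)
    then show "(w, s) \<in> (\<Union>i\<in>UNIV. U i)" by blast
  qed
  moreover have "compact ({0..1::real} \<times> ({0..1} \<inter> K))"
    by (intro compact_Times compact_Int_closed compact_Icc) (simp add: K_def closed_limit_set)
  ultimately obtain I where I: "finite I" "{0..1} \<times> ({0..1} \<inter> K) \<subseteq> (\<Union>i\<in>I. U i)"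
    by (metis compactE_image)
  have "\<exists>i\<le>Max I. \<bar>g ((\<Phi> ^^ i) w) - g s\<bar> < \<epsilon>" if s: "s \<in> K" for w s
  proof -
    have w_eq: "w = frac w + of_int \<lfloor>w\<rfloor>" and s_eq: "s = frac s + of_int \<lfloor>s\<rfloor>"
      by (simp_all add: frac_def)
    have "frac s \<in> K" using s s_eq limit_set_translate K_def by metis
    then have "(frac w, frac s) \<in> {0..1} \<times> ({0..1} \<inter> K)" by (simp add: frac_lt_1 less_imp_le)
    then obtain i where i: "i \<in> I" "(frac w, frac s) \<in> U i" using I(2) by blast
    have "g ((\<Phi> ^^ i) w) = g ((\<Phi> ^^ i) (frac w))" "g s = g (frac s)"
      using w_eq s_eq g_per funpow_add_int by metis+
    then show ?thesis using i I(1) by (intro exI[of _ i]) (simp add: U_def)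
  qed
  then show ?thesis unfolding g_def K_def by blast
qed

theorem almost_strongly_recurrent_displacement:
  assumes x: "x \<in> limit_set v"
  shows "almost_strongly_recurrent (displacement \<Phi> x)"
  unfolding almost_strongly_recurrent_def
proof safe
  fix \<epsilon> :: real assume "\<epsilon> > 0"
  from uniform_approximation_of_displacement[OF this, of v]
  obtain N where N: "\<forall>w. \<forall>s\<in>limit_set v. \<exists>i\<le>N.
      \<bar>frac (\<Phi> ((\<Phi> ^^ i) w) - (\<Phi> ^^ i) w) - frac (\<Phi> s - s)\<bar> < \<epsilon>" ..
  have disp: "displacement \<Phi> x (Suc m) = frac (\<Phi> ((\<Phi> ^^ m) x) - (\<Phi> ^^ m) x)" for m
    by (simp add: displacement_def)
  have "\<exists>i\<in>{0..max 1 N}. \<bar>displacement \<Phi> x (n + k + i) - displacement \<Phi> x n\<bar> < \<epsilon>"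
    if n: "n \<ge> 1" for n k
  proof -
    obtain m where m: "n = Suc m" using n by (cases n) auto
    have "(\<Phi> ^^ m) x \<in> limit_set v"
      using x invariant_funpow[OF invariant_limit_set] by simp
    with N obtain i where i: "i \<le> N"
      "\<bar>frac (\<Phi> ((\<Phi> ^^ i) ((\<Phi> ^^ (m + k)) x)) - (\<Phi> ^^ i) ((\<Phi> ^^ (m + k)) x))
         - frac (\<Phi> ((\<Phi> ^^ m) x) - (\<Phi> ^^ m) x)\<bar> < \<epsilon>"
      by blast
    have "(\<Phi> ^^ i) ((\<Phi> ^^ (m + k)) x) = (\<Phi> ^^ (i + (m + k))) x"
      by (simp only: funpow_add comp_apply)
    moreover have "n + k + i = Suc (i + (m + k))" by (simp add: m)
    ultimately have "\<bar>displacement \<Phi> x (n + k + i) - displacement \<Phi> x n\<bar> < \<epsilon>"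
      using i(2) by (simp only: disp m)
    then show ?thesis using i(1) by (intro bexI[of _ i]) simp_all
  qed
  then show "\<exists>N\<ge>1. \<forall>n\<ge>1. \<forall>k. \<exists>i\<in>{0..N}.
      \<bar>displacement \<Phi> x (n + k + i) - displacement \<Phi> x n\<bar> < \<epsilon>"
    by (intro exI[of _ "max 1 N"]) simp
qed

end

section \<open>Minimality and transitivity on the circle\<close>

locale irrational_circle_homeo = irrational_lift +
  fixes \<phi> :: "complex \<Rightarrow> complex"
  assumes semiconj: "circle_cover (\<Phi> x) = \<phi> (circle_cover x)"
    and onto: "\<phi> ` circle = circle"
    and inj: "inj_on \<phi> circle"
begin

lemma semiconj_funpow: "circle_cover ((\<Phi> ^^ n) x) = (\<phi> ^^ n) (circle_cover x)"
  by (induction n) (auto simp: semiconj)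

lemma funpow_in_circle: "z \<in> circle \<Longrightarrow> (\<phi> ^^ n) z \<in> circle"
  by (metis circle_cover_in_circle circle_cover_onto semiconj_funpow)

lemma funpow_inj:
  assumes "z \<in> circle" "w \<in> circle" "(\<phi> ^^ n) z = (\<phi> ^^ n) w"
  shows "z = w"
  using assms(3)
proof (induction n)
  case (Suc n)
  then show ?case using inj_onD[OF inj] funpow_in_circle assms(1,2) by simp
qed simp

lemma orbit_comparable:
  assumes x: "x \<in> circle"
    and u: "u \<in> {y \<in> circle. \<exists>n. y = (\<phi> ^^ n) x \<or> (\<phi> ^^ n) y = x}"
    and v: "v \<in> {y \<in> circle. \<exists>n. y = (\<phi> ^^ n) x \<or> (\<phi> ^^ n) y = x}"
  shows "\<exists>n. (\<phi> ^^ n) u = v \<or> (\<phi> ^^ n) v = u"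
proof -
  have split: "(\<phi> ^^ j) y = (\<phi> ^^ (j - i)) ((\<phi> ^^ i) y)"
    "(\<phi> ^^ j) y = (\<phi> ^^ i) ((\<phi> ^^ (j - i)) y)" if "i \<le> j" for i j y
    using that fun_cong[OF funpow_add[of "j - i" i \<phi>], of y]
      fun_cong[OF funpow_add[of i "j - i" \<phi>], of y] by simp_all
  obtain i j where "u = (\<phi> ^^ i) x \<or> (\<phi> ^^ i) u = x" "v = (\<phi> ^^ j) x \<or> (\<phi> ^^ j) v = x"
    using u v by blast
  then consider "u = (\<phi> ^^ i) x" "v = (\<phi> ^^ j) x" | "u = (\<phi> ^^ (i + j)) v"
    | "v = (\<phi> ^^ (j + i)) u" | "(\<phi> ^^ i) u = (\<phi> ^^ j) v"
    by (auto simp: funpow_add)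
  then show ?thesis
  proof cases
    case 1
    then show ?thesis using split(1)[of i j x] split(1)[of j i x] by (metis nle_le)
  next
    case 4
    have "u \<in> circle" "v \<in> circle" using u v by auto
    then have "u = (\<phi> ^^ (j - i)) v" if "i \<le> j"
      using funpow_inj[of u _ i] funpow_in_circle 4 split(2)[OF that] by metis
    moreover have "v = (\<phi> ^^ (i - j)) u" if "j \<le> i"
      using \<open>u \<in> circle\<close> \<open>v \<in> circle\<close> funpow_inj[of v _ j] funpow_in_circle 4 split(2)[OF that]
      by metis
    ultimately show ?thesis by (metis nle_le)
  qed metis+
qed

lemma invariant_vimage:
  assumes "closed_invariant_circle_set \<phi> M"
  shows "invariant (circle_cover -` M)"
proof -
  have M: "M \<noteq> {}" "M \<subseteq> circle" "closed M" "\<phi> ` M = M"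
    using assms by (auto simp: closed_invariant_circle_set_def)
  have "circle_cover -` M \<noteq> {}" using M(1,2) circle_cover_onto by blast
  moreover have "closed (circle_cover -` M)"
    using closed_vimage[OF M(3) continuous_on_circle_cover] .
  moreover have "\<phi> (circle_cover x) \<in> M \<longleftrightarrow> circle_cover x \<in> M" for x
  proof
    assume "\<phi> (circle_cover x) \<in> M"
    then obtain y where "y \<in> M" "\<phi> y = \<phi> (circle_cover x)" using M(4) by (metis imageE)
    then show "circle_cover x \<in> M"
      using inj_onD[OF inj, of y "circle_cover x"] M(2) circle_cover_in_circle[of x] by blast
  qed (use M(4) in blast)
  ultimately show ?thesis by (simp add: invariant_def semiconj)
qed

lemma closed_invariant_image:
  assumes S: "invariant S"
  shows "closed_invariant_circle_set \<phi> (circle_cover ` S)"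
proof -
  have "closed (circle_cover ` S)"
    using S by (intro closed_circle_cover_image) (auto simp: invariant_def)
  moreover have "\<phi> ` circle_cover ` S = circle_cover ` S"
  proof
    have "\<phi> (circle_cover t) \<in> circle_cover ` S" if "t \<in> S" for t
      using that S by (simp add: semiconj[symmetric] invariant_def)
    then show "\<phi> ` circle_cover ` S \<subseteq> circle_cover ` S" by blast
    show "circle_cover ` S \<subseteq> \<phi> ` circle_cover ` S"
    proof clarify
      fix t assume t: "t \<in> S"
      obtain z where z: "z \<in> circle" "\<phi> z = circle_cover t"
        using onto circle_cover_in_circle by (metis imageE)
      obtain u where u: "circle_cover u = z" using circle_cover_onto[OF z(1)] .
      then have "circle_cover (\<Phi> u) = circle_cover t" using z(2) semiconj by simp
      then obtain k :: int where "\<Phi> u = t + of_int k" by (auto simp: circle_cover_eq_iff)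
      then have "\<Phi> u \<in> S" using t S by (simp add: invariant_translate)
      then have "u \<in> S" using S by (simp add: invariant_def)
      then show "circle_cover t \<in> \<phi> ` circle_cover ` S" using u z(2) by (metis imageI)
    qed
  qed
  moreover have "circle_cover ` S \<subseteq> circle" using circle_cover_in_circle by blast
  ultimately show ?thesis
    using S by (simp add: closed_invariant_circle_set_def invariant_def)
qed

lemma the_minimal_set_eq: "the_minimal_set \<phi> = circle_cover ` limit_set v"
proof -
  let ?M = "circle_cover ` limit_set v"
  have inv: "closed_invariant_circle_set \<phi> ?M"
    by (rule closed_invariant_image[OF invariant_limit_set])
  have least: "?M \<subseteq> M" if "closed_invariant_circle_set \<phi> M" for M
    using limit_set_least[OF invariant_vimage[OF that]] by blast
  show ?thesis
    unfolding the_minimal_set_def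
  proof (rule the_equality)
    show "is_minimal_set \<phi> ?M" using inv least unfolding is_minimal_set_def by blast
    show "M = ?M" if "is_minimal_set \<phi> M" for M
      using that inv least unfolding is_minimal_set_def by metis
  qed
qed

text \<open>Otherwise the points of the line over a dense orbit would be dense in a gap of \<open>S\<close>, and two
  of them that are less than 1 apart in one gap contradict \<open>invariant_meets_segment\<close>.\<close>

lemma transitive_imp_invariant_trivial:
  assumes trans: "transitive_circle_map \<phi>" and S: "invariant S"
  shows "S = UNIV"
proof (rule ccontr)
  assume "S \<noteq> UNIV"
  then obtain y where "y \<notin> S" by blast
  then obtain e' where e': "e' > 0" "\<And>t. \<bar>t - y\<bar> < e' \<Longrightarrow> t \<notin> S"
    using S unfolding invariant_def closed_def open_dist dist_real_def by (metis ComplD ComplI)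
  \<comment> \<open>An interval of length at most 1 contains at most one point over each point of the circle.\<close>
  define e where "e = min e' 1"
  have e: "e > 0" "e \<le> 1" "\<And>t. \<bar>t - y\<bar> < e \<Longrightarrow> t \<notin> S" using e' by (auto simp: e_def)
  obtain x where x: "x \<in> circle"
    and dense: "circle \<subseteq> closure {y \<in> circle. \<exists>n. y = (\<phi> ^^ n) x \<or> (\<phi> ^^ n) y = x}"
    using trans unfolding has_dense_orbit_on_def by blast
  define orb where "orb = {y \<in> circle. \<exists>n. y = (\<phi> ^^ n) x \<or> (\<phi> ^^ n) y = x}"
  have hit: "\<exists>t. c < t \<and> t < d \<and> circle_cover t \<in> orb" if "c < d" for c d
  proof (rule ccontr)
    assume no: "\<nexists>t. c < t \<and> t < d \<and> circle_cover t \<in> orb"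
    \<comment> \<open>The points with no translate in the interval project to a closed set that contains the
      orbit but not the projection of the midpoint.\<close>
    define F where "F = (\<Inter>k::int. {t. t + of_int k \<notin> {c<..<d}})"
    have "closed {t. t + of_int k \<notin> {c<..<d}}" for k :: int
    proof -
      have "{t. t + of_int k \<notin> {c<..<d}} = {t. t + of_int k \<le> c} \<union> {t. d \<le> t + of_int k}"
        by auto
      then show ?thesis
        by (simp only:) (intro closed_Un closed_Collect_le continuous_intros)
    qed
    then have "closed F" unfolding F_def by blast
    moreover have "t + of_int j \<in> F \<longleftrightarrow> t \<in> F" for t and j :: int
    proof -
      have shift: "t + of_int j \<in> F" if "t \<in> F" for t and j :: int
        unfolding F_def
      proof
        fix k :: int
        have "t + of_int (j + k) \<notin> {c<..<d}" using that by (auto simp only: F_def)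
        then show "t + of_int j \<in> {t. t + of_int k \<notin> {c<..<d}}" by (simp add: add.assoc)
      qed
      show ?thesis using shift[of t j] shift[of "t + of_int j" "- j"] by auto
    qed
    ultimately have "closed (circle_cover ` F)" by (rule closed_circle_cover_image)
    moreover have "orb \<subseteq> circle_cover ` F"
    proof
      fix v assume v: "v \<in> orb"
      then have "v \<in> circle" by (simp add: orb_def)
      then obtain t where t: "circle_cover t = v" using circle_cover_onto by blast
      have "t + of_int k \<notin> {c<..<d}" for k :: int
        using no v t circle_cover_add_int[of t k] by auto
      then show "v \<in> circle_cover ` F" using t by (auto simp: F_def)
    qed
    ultimately have "circle \<subseteq> circle_cover ` F"
      using dense closure_minimal unfolding orb_def by blast
    then obtain f where f: "f \<in> F" "circle_cover ((c + d) / 2) = circle_cover f"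
      using circle_cover_in_circle by blast
    then obtain k :: int where "(c + d) / 2 = f + of_int k" by (auto simp: circle_cover_eq_iff)
    moreover have "f + of_int k \<notin> {c<..<d}" using f(1) by (auto simp only: F_def)
    ultimately show False using \<open>c < d\<close> by (auto simp: field_simps)
  qed
  obtain p where p: "y - e < p" "p < y" "circle_cover p \<in> orb"
    using hit[of "y - e" y] e(1) by auto
  obtain q where q: "p < q" "q < y" "circle_cover q \<in> orb"
    using hit[of p y] p(2) by auto
  have no_return: False
    if st: "(\<phi> ^^ n) (circle_cover s) = circle_cover t" "{s, t} = {p, q}" for s t n
  proof -
    have in_gap: "s \<in> {y - e<..<y}" "t \<in> {y - e<..<y}"
      using st(2) p q by (auto simp: doubleton_eq_iff)
    have "circle_cover t = circle_cover ((\<Phi> ^^ n) s)" using st(1) semiconj_funpow by simp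
    then obtain k :: int where k: "t = (\<Phi> ^^ n) s + of_int k"
      by (auto simp: circle_cover_eq_iff)
    show False
    proof (cases "n = 0")
      case False
      have "s \<notin> S" using e(3) in_gap by auto
      then obtain r where r: "r \<in> S" "r \<in> closed_segment s t"
        using invariant_meets_segment[OF S, of s n k] False k by auto
      then have "\<bar>r - y\<bar> < e"
        using in_gap by (auto simp: closed_segment_eq_real_ivl split: if_splits)
      then show False using e(3) r(1) by blast
    next
      case True
      then have eq: "t = s + of_int k" using k by simp
      then have "\<bar>of_int k\<bar> < (1::real)" using in_gap e(2) by auto
      then have "t = s" using eq by simp
      then show False using st(2) q(1) by (auto simp: doubleton_eq_iff)
    qed
  qed
  show False
    using orbit_comparable[OF x p(3)[unfolded orb_def] q(3)[unfolded orb_def]]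
      no_return[of _ p q] no_return[of _ q p] by blast
qed

end

theorem proposition3p20:
  fixes \<phi> :: "complex \<Rightarrow> complex" and \<Phi> :: "real \<Rightarrow> real"
  assumes "orientation_preserving_circle_homeo \<phi>"
    and "is_lift \<phi> \<Phi>"
    and "rotation_number \<Phi> \<notin> \<rat>"
  shows "(transitive_circle_map \<phi> \<longrightarrow>
            (\<forall>z\<in>circle. \<forall>x. circle_cover x = z \<longrightarrow>
               almost_strongly_recurrent (displacement \<Phi> x))) \<and>
         (\<not> transitive_circle_map \<phi> \<longrightarrow>
            (\<forall>z\<in>the_minimal_set \<phi>. \<forall>x. circle_cover x = z \<longrightarrow>
               almost_strongly_recurrent (displacement \<Phi> x)))"
proof -
  interpret degree_one_lift \<Phi> by (rule lift_degree_one[OF assms(1,2)])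
  obtain \<psi> where \<psi>: "homeomorphism circle circle \<phi> \<psi>"
    using assms(1) unfolding orientation_preserving_circle_homeo_def by blast
  interpret irrational_circle_homeo \<Phi> \<phi>
  proof
    show "(\<Phi> ^^ q) x \<noteq> x + of_int p" if "q \<ge> 1" for q x and p :: int
      using periodic_imp_rational_rotation_number[OF _ that] assms(3) by blast
    show "circle_cover (\<Phi> x) = \<phi> (circle_cover x)" for x
      using assms(2) by (simp add: is_lift_def)
    show "\<phi> ` circle = circle" by (rule homeomorphism_image1[OF \<psi>])
    show "inj_on \<phi> circle" using homeomorphism_apply1[OF \<psi>] by (rule inj_on_inverseI)
  qed
  have "almost_strongly_recurrent (displacement \<Phi> x)" if "transitive_circle_map \<phi>" for x
    using almost_strongly_recurrent_displacement[of x 0]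
      transitive_imp_invariant_trivial[OF that invariant_limit_set] by simp
  moreover have "almost_strongly_recurrent (displacement \<Phi> x)"
    if x: "circle_cover x \<in> the_minimal_set \<phi>" for x
  proof -
    obtain t where t: "t \<in> limit_set 0" "circle_cover x = circle_cover t"
      using x unfolding the_minimal_set_eq[of 0] by blast
    then obtain k :: int where "x = t + of_int k" by (auto simp: circle_cover_eq_iff)
    then have "x \<in> limit_set 0" using t(1) by (simp add: limit_set_translate)
    then show ?thesis by (rule almost_strongly_recurrent_displacement)
  qed
  ultimately show ?thesis by blast
qed

end
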